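(* Let $\mathbf{L}$ be a complete lattice equipped with a binary operation $\ast$ that is monotone in both variables, and let $\mathsf{F}_{\mathbf{L}}=(F_{\mathbf{L}},e,m)$ be the $\mathbf{L}$-valued filter monad. The category $\mathbf{Alg}(\mathsf{F}_{\mathbf{L}},\mathbf{2})$ of $(\mathsf{F}_{\mathbf{L}},\mathbf{2})$-algebras associated to the Kleisli extension of $F_{\mathbf{L}}$ is isomorphic to the category $\mathbf{Top}(\mathbf{L})$ of $\mathbf{L}$-valued topological spaces: $$\mathbf{Alg}(\mathsf{F}_{\mathbf{L}},\mathbf{2})\cong\mathbf{Top}(\mathbf{L}).$$
   Context: **$\mathbf{L}$-valued filter monad.** $\mathbf{L}^X$ is the set of maps $X\to\mathbf{L}$, with pointwise order and pointwise operation $\ast$; $\top^X$ is its top element (constant $\top$). An $\mathbf{L}$-valued filter on $X$ is a map $\mathfrak{f}:\mathbf{L}^X\to\mathbf{L}$ such that for all $A,B\in\mathbf{L}^X$: $\mathfrak{f}(\top^X)=\top$; $A\le B$ implies $\mathfrak{f}(A)\le\mathfrak{f}(B)$; $\mathfrak{f}(A)\ast\mathfrak{f}(B)\le\mathfrak{f}(A\ast B)$. $F_{\mathbf{L}}X$ is the set of all $\mathbf{L}$-valued filters on $X$, ordered by $\mathfrak{f}\le\mathfrak{g}\iff\mathfrak{g}(A)\le\mathfrak{f}(A)$ for all $A\in\mathbf{L}^X$; it is a complete lattice. For $f:X\to Y$, $F_{\mathbf{L}}f:F_{\mathbf{L}}X\to F_{\mathbf{L}}Y$ is $[F_{\mathbf{L}}f(\mathfrak{f})](A)=\mathfrak{f}(A\cdot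 f)$ for $A\in\mathbf{L}^Y$. The monad structure is $[e_X(x)](A)=A(x)$ and $[m_X(\mathfrak{F})](A)=\mathfrak{F}(\mathrm{ev}_A)$, where $\mathrm{ev}_A:F_{\mathbf{L}}X\to\mathbf{L}$, $\mathrm{ev}_A(\mathfrak{f})=\mathfrak{f}(A)$, for $A\in\mathbf{L}^X$, $\mathfrak{F}\in F_{\mathbf{L}}^2X$. Below write $T=F_{\mathbf{L}}$. **$\mathbf{L}$-valued topological spaces.** Maps into $TX$ are ordered pointwise, and the Kleisli composite of $\alpha:X\to TY$ and $\beta:Y\to TZ$ is $\beta\circ\alpha:=m_Z\cdot T\beta\cdot\alpha$. $\mathbf{Top}(\mathbf{L})$ is the category of Kleisli $\mathsf{F}_{\mathbf{L}}$-algebras: objects are pairs $(X,\alpha)$ with $X$ a set and $\alpha:X\to TX$ a map with $e_X\le\alpha$ and $\alpha\circ\alpha\le\alpha$; morphisms $f:(X,\alpha)\to(Y,\beta)$ are maps $f:X\to Y$ with $(e_Y\cdot f)\circ\alpha\le\beta\circ(e_Y\cdot f)$ (equivalently $Tf\cdot\alpha\le\beta\cdot f$), composing as in $\mathbf{Set}$. **Matrices and Kleisli extension.** $\mathbf{2}=\{\bot<\top\}$, a quantale with $\otimes=\wedge$ and unit $\top$. A $\mathbf{2}$-matrix $r:X\nrightarrow Y$ is a map $X\times Y\to\mathbf{2}$ (a relation), ordered pointwise, with relational composition $(s\cdot r)(x,z)=\bigvee_y r(x,y)\wedge s(y,z)$; $1_X(x,y)=\top$ iff $x=y$; a map $f:X\to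 Y$ is identified with its graph. Let $\eta_X:PX\to TX$ ($PX$ the powerset), $\eta_X(A)=\bigvee\{e_X(x)\mid x\in A\}$. For $r:X\nrightarrow Y$ and $a\in\mathbf{2}$ let $\rho_r^a:Y\to PX$, $\rho_r^a(y)=\{x\in X\mid a\le r(x,y)\}$. The Kleisli extension $T_M$ of $T$ sends $r:X\nrightarrow Y$ to $T_Mr:TX\nrightarrow TY$, $$T_Mr(\mathfrak{x},\mathfrak{y}):=\bigvee\{a\in\mathbf{2}\mid\mathfrak{x}\le m_X\cdot T(\eta_X\cdot\rho_r^a)(\mathfrak{y})\}.$$ **Lax algebras.** Objects of $\mathbf{Alg}(\mathsf{F}_{\mathbf{L}},\mathbf{2})$ are pairs $(X,r)$ with $X$ a set and $r:TX\nrightarrow X$ a $\mathbf{2}$-matrix with $1_X\le r\cdot e_X$ and $r\cdot T_Mr\le r\cdot m_X$. Morphisms $f:(X,r)\to(Y,s)$ are maps $f:X\to Y$ with $r(\mathfrak{x},y)\le s(Tf(\mathfrak{x}),f(y))$ for all $\mathfrak{x}\in TX$, $y\in X$; composition is as in $\mathbf{Set}$. *)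

theory Defs
  imports "HOL-Algebra.Complete_Lattice"
begin

section \<open>Categories and isomorphism of categories\<close>

text \<open>Hom-sets of different pairs of objects need not be disjoint, so composition and the morphism
  part of a functor take the objects involved as arguments. \<open>Cmp \<C> A B C g f\<close> is the
  composite of \<open>f : A \<rightarrow> B\<close> and \<open>g : B \<rightarrow> C\<close>.\<close>

record ('o, 'm) cat =
  Obj :: "'o set"
  Hom :: "'o \<Rightarrow> 'o \<Rightarrow> 'm set"
  Ident :: "'o \<Rightarrow> 'm"
  Cmp :: "'o \<Rightarrow> 'o \<Rightarrow> 'o \<Rightarrow> 'm \<Rightarrow> 'm \<Rightarrow> 'm"

definition is_category :: "('o, 'm) cat \<Rightarrow> bool" where
  "is_category \<C> \<longleftrightarrow>
     (\<forall>A\<in>Obj \<C>. Ident \<C> A \<in> Hom \<C> A A) \<and>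
     (\<forall>A\<in>Obj \<C>. \<forall>B\<in>Obj \<C>. \<forall>C\<in>Obj \<C>. \<forall>f\<in>Hom \<C> A B. \<forall>g\<in>Hom \<C> B C.
        Cmp \<C> A B C g f \<in> Hom \<C> A C) \<and>
     (\<forall>A\<in>Obj \<C>. \<forall>B\<in>Obj \<C>. \<forall>f\<in>Hom \<C> A B.
        Cmp \<C> A A B f (Ident \<C> A) = f \<and> Cmp \<C> A B B (Ident \<C> B) f = f) \<and>
     (\<forall>A\<in>Obj \<C>. \<forall>B\<in>Obj \<C>. \<forall>C\<in>Obj \<C>. \<forall>D\<in>Obj \<C>.
        \<forall>f\<in>Hom \<C> A B. \<forall>g\<in>Hom \<C> B C. \<forall>h\<in>Hom \<C> C D.
        Cmp \<C> A C D h (Cmp \<C> A B C g f) = Cmp \<C> A B D (Cmp \<C> B C D h g) f)"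

definition is_functor ::
  "('o, 'm) cat \<Rightarrow> ('p, 'n) cat \<Rightarrow> ('o \<Rightarrow> 'p) \<Rightarrow> ('o \<Rightarrow> 'o \<Rightarrow> 'm \<Rightarrow> 'n) \<Rightarrow> bool" where
  "is_functor \<C> \<D> Fo Fm \<longleftrightarrow>
     (\<forall>A\<in>Obj \<C>. Fo A \<in> Obj \<D>) \<and>
     (\<forall>A\<in>Obj \<C>. \<forall>B\<in>Obj \<C>. \<forall>f\<in>Hom \<C> A B. Fm A B f \<in> Hom \<D> (Fo A) (Fo B)) \<and>
     (\<forall>A\<in>Obj \<C>. Fm A A (Ident \<C> A) = Ident \<D> (Fo A)) \<and>
     (\<forall>A\<in>Obj \<C>. \<forall>B\<in>Obj \<C>. \<forall>C\<in>Obj \<C>. \<forall>f\<in>Hom \<C> A B. \<forall>g\<in>Hom \<C> B C.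
        Fm A C (Cmp \<C> A B C g f) = Cmp \<D> (Fo A) (Fo B) (Fo C) (Fm B C g) (Fm A B f))"

definition isomorphic_categories :: "('o, 'm) cat \<Rightarrow> ('p, 'n) cat \<Rightarrow> bool" where
  "isomorphic_categories \<C> \<D> \<longleftrightarrow>
     is_category \<C> \<and> is_category \<D> \<and>
     (\<exists>Fo Fm Go Gm.
        is_functor \<C> \<D> Fo Fm \<and> is_functor \<D> \<C> Go Gm \<and>
        (\<forall>A\<in>Obj \<C>. Go (Fo A) = A) \<and>
        (\<forall>A\<in>Obj \<C>. \<forall>B\<in>Obj \<C>. \<forall>f\<in>Hom \<C> A B. Gm (Fo A) (Fo B) (Fm A B f) = f) \<and>
        (\<forall>A\<in>Obj \<D>. Fo (Go A) = A) \<and>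
        (\<forall>A\<in>Obj \<D>. \<forall>B\<in>Obj \<D>. \<forall>f\<in>Hom \<D> A B. Fm (Go A) (Go B) (Gm A B f) = f))"

section \<open>The L-valued filter monad\<close>

text \<open>Sets are subsets of types, and maps \<open>X \<rightarrow> Y\<close> are elements of \<open>X \<rightarrow>\<^sub>E Y\<close>, so that
  equality in HOL is equality of maps. In particular the elements of \<open>LF ast X\<close> are extensional
  on \<open>Lpow X\<close>. The lattice is the type \<open>'l\<close>, its operation is the parameter \<open>ast\<close>.\<close>

definition Lpow :: "'a set \<Rightarrow> ('a \<Rightarrow> 'l) set" where
  "Lpow X = X \<rightarrow>\<^sub>E UNIV"

definition is_Lfilter ::
  "('l \<Rightarrow> 'l \<Rightarrow> 'l) \<Rightarrow> 'a set \<Rightarrow> (('a \<Rightarrow> 'l::complete_lattice) \<Rightarrow> 'l) \<Rightarrow> bool" where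
  "is_Lfilter ast X \<ff> \<longleftrightarrow>
     \<ff> \<in> Lpow X \<rightarrow>\<^sub>E UNIV \<and>
     \<ff> (\<lambda>x\<in>X. Orderings.top) = Orderings.top \<and>
     (\<forall>A\<in>Lpow X. \<forall>B\<in>Lpow X. (\<forall>x\<in>X. A x \<le> B x) \<longrightarrow> \<ff> A \<le> \<ff> B) \<and>
     (\<forall>A\<in>Lpow X. \<forall>B\<in>Lpow X. ast (\<ff> A) (\<ff> B) \<le> \<ff> (\<lambda>x\<in>X. ast (A x) (B x)))"

definition LF ::
  "('l \<Rightarrow> 'l \<Rightarrow> 'l) \<Rightarrow> 'a set \<Rightarrow> (('a \<Rightarrow> 'l::complete_lattice) \<Rightarrow> 'l) set" where
  "LF ast X = {\<ff>. is_Lfilter ast X \<ff>}"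

definition LFord ::
  "('l \<Rightarrow> 'l \<Rightarrow> 'l) \<Rightarrow> 'a set \<Rightarrow> (('a \<Rightarrow> 'l::complete_lattice) \<Rightarrow> 'l) gorder" where
  "LFord ast X =
     \<lparr>carrier = LF ast X, eq = (=), le = (\<lambda>\<ff> \<gg>. \<forall>A\<in>Lpow X. \<gg> A \<le> \<ff> A)\<rparr>"

definition LFmap ::
  "('l \<Rightarrow> 'l \<Rightarrow> 'l) \<Rightarrow> 'a set \<Rightarrow> 'b set \<Rightarrow> ('a \<Rightarrow> 'b) \<Rightarrow>
   (('a \<Rightarrow> 'l::complete_lattice) \<Rightarrow> 'l) \<Rightarrow> (('b \<Rightarrow> 'l) \<Rightarrow> 'l)" where
  "LFmap ast X Y f = (\<lambda>\<ff>\<in>LF ast X. \<lambda>A\<in>Lpow Y. \<ff> (compose X A f))"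

definition LFunit :: "'a set \<Rightarrow> 'a \<Rightarrow> (('a \<Rightarrow> 'l) \<Rightarrow> 'l)" where
  "LFunit X = (\<lambda>x\<in>X. \<lambda>A\<in>Lpow X. A x)"

definition LFev ::
  "('l \<Rightarrow> 'l \<Rightarrow> 'l) \<Rightarrow> 'a set \<Rightarrow> ('a \<Rightarrow> 'l::complete_lattice) \<Rightarrow> (('a \<Rightarrow> 'l) \<Rightarrow> 'l) \<Rightarrow> 'l" where
  "LFev ast X A = (\<lambda>\<ff>\<in>LF ast X. \<ff> A)"

definition LFmult ::
  "('l \<Rightarrow> 'l \<Rightarrow> 'l) \<Rightarrow> 'a set \<Rightarrow>
   (((('a \<Rightarrow> 'l::complete_lattice) \<Rightarrow> 'l) \<Rightarrow> 'l) \<Rightarrow> 'l) \<Rightarrow> (('a \<Rightarrow> 'l) \<Rightarrow> 'l)" where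
  "LFmult ast X = (\<lambda>\<FF>\<in>LF ast (LF ast X). \<lambda>A\<in>Lpow X. \<FF> (LFev ast X A))"

section \<open>L-valued topological spaces\<close>

definition LFmap_le ::
  "('l \<Rightarrow> 'l \<Rightarrow> 'l) \<Rightarrow> 'b set \<Rightarrow> 'a set \<Rightarrow>
   ('b \<Rightarrow> (('a \<Rightarrow> 'l::complete_lattice) \<Rightarrow> 'l)) \<Rightarrow> ('b \<Rightarrow> (('a \<Rightarrow> 'l) \<Rightarrow> 'l)) \<Rightarrow> bool" where
  "LFmap_le ast X Y \<alpha> \<beta> \<longleftrightarrow> (\<forall>x\<in>X. \<alpha> x \<sqsubseteq>\<^bsub>LFord ast Y\<^esub> \<beta> x)"

text \<open>The Kleisli composite of \<open>\<alpha> : X \<rightarrow> TY\<close> and \<open>\<beta> : Y \<rightarrow> TZ\<close>.\<close>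

definition LFkleisli ::
  "('l \<Rightarrow> 'l \<Rightarrow> 'l) \<Rightarrow> 'a set \<Rightarrow> 'b set \<Rightarrow> 'c set \<Rightarrow>
   ('b \<Rightarrow> (('c \<Rightarrow> 'l::complete_lattice) \<Rightarrow> 'l)) \<Rightarrow> ('a \<Rightarrow> (('b \<Rightarrow> 'l) \<Rightarrow> 'l)) \<Rightarrow>
   'a \<Rightarrow> (('c \<Rightarrow> 'l) \<Rightarrow> 'l)" where
  "LFkleisli ast X Y Z \<beta> \<alpha> =
     compose X (LFmult ast Z) (compose X (LFmap ast Y (LF ast Z) \<beta>) \<alpha>)"

definition LTop_obj ::
  "('l \<Rightarrow> 'l \<Rightarrow> 'l) \<Rightarrow> ('a set \<times> ('a \<Rightarrow> (('a \<Rightarrow> 'l::complete_lattice) \<Rightarrow> 'l))) set" where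
  "LTop_obj ast =
     {(X, \<alpha>). \<alpha> \<in> X \<rightarrow>\<^sub>E LF ast X \<and>
        LFmap_le ast X X (LFunit X) \<alpha> \<and>
        LFmap_le ast X X (LFkleisli ast X X X \<alpha> \<alpha>) \<alpha>}"

definition LTop_hom ::
  "('l \<Rightarrow> 'l \<Rightarrow> 'l) \<Rightarrow> ('a set \<times> ('a \<Rightarrow> (('a \<Rightarrow> 'l::complete_lattice) \<Rightarrow> 'l))) \<Rightarrow>
   ('a set \<times> ('a \<Rightarrow> (('a \<Rightarrow> 'l) \<Rightarrow> 'l))) \<Rightarrow> ('a \<Rightarrow> 'a) set" where
  "LTop_hom ast = (\<lambda>(X, \<alpha>) (Y, \<beta>).
     {f \<in> X \<rightarrow>\<^sub>E Y.
        LFmap_le ast X Y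
          (LFkleisli ast X X Y (compose X (LFunit Y) f) \<alpha>)
          (LFkleisli ast X Y Y \<beta> (compose X (LFunit Y) f))})"

definition LTop ::
  "('l \<Rightarrow> 'l \<Rightarrow> 'l) \<Rightarrow>
   ('a set \<times> ('a \<Rightarrow> (('a \<Rightarrow> 'l::complete_lattice) \<Rightarrow> 'l)), 'a \<Rightarrow> 'a) cat" where
  "LTop ast =
     \<lparr>Obj = LTop_obj ast, Hom = LTop_hom ast,
      Ident = (\<lambda>(X, \<alpha>). \<lambda>x\<in>X. x),
      Cmp = (\<lambda>(X, \<alpha>) _ _ g f. compose X g f)\<rparr>"

section \<open>Matrices over 2 and the Kleisli extension\<close>

text \<open>The quantale 2 is the type \<^typ>\<open>bool\<close> with its lattice structure, where \<^term>\<open>False \<le> True\<close>.\<close>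

type_synonym ('a, 'b) mat2 = "'a \<times> 'b \<Rightarrow> bool"

definition mat2 :: "'a set \<Rightarrow> 'b set \<Rightarrow> ('a, 'b) mat2 set" where
  "mat2 X Y = X \<times> Y \<rightarrow>\<^sub>E UNIV"

definition mat2_le :: "'a set \<Rightarrow> 'b set \<Rightarrow> ('a, 'b) mat2 \<Rightarrow> ('a, 'b) mat2 \<Rightarrow> bool" where
  "mat2_le X Y r s \<longleftrightarrow> (\<forall>p\<in>X \<times> Y. r p \<le> s p)"

definition mat2_comp ::
  "'a set \<Rightarrow> 'b set \<Rightarrow> 'c set \<Rightarrow> ('b, 'c) mat2 \<Rightarrow> ('a, 'b) mat2 \<Rightarrow> ('a, 'c) mat2" where
  "mat2_comp X Y Z s r = (\<lambda>(x, z)\<in>X \<times> Z. SUP y\<in>Y. r (x, y) \<and> s (y, z))"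

definition mat2_id :: "'a set \<Rightarrow> ('a, 'a) mat2" where
  "mat2_id X = (\<lambda>(x, y)\<in>X \<times> X. x = y)"

definition mat2_graph :: "'a set \<Rightarrow> 'b set \<Rightarrow> ('a \<Rightarrow> 'b) \<Rightarrow> ('a, 'b) mat2" where
  "mat2_graph X Y f = (\<lambda>(x, y)\<in>X \<times> Y. f x = y)"

definition LFeta ::
  "('l \<Rightarrow> 'l \<Rightarrow> 'l) \<Rightarrow> 'a set \<Rightarrow> 'a set \<Rightarrow> (('a \<Rightarrow> 'l::complete_lattice) \<Rightarrow> 'l)" where
  "LFeta ast X = (\<lambda>A\<in>Pow X. \<Squnion>\<^bsub>LFord ast X\<^esub> (LFunit X ` A))"

definition mat2_rho :: "'a set \<Rightarrow> 'b set \<Rightarrow> ('a, 'b) mat2 \<Rightarrow> bool \<Rightarrow> 'b \<Rightarrow> 'a set" where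
  "mat2_rho X Y r a = (\<lambda>y\<in>Y. {x \<in> X. a \<le> r (x, y)})"

definition LFext ::
  "('l \<Rightarrow> 'l \<Rightarrow> 'l) \<Rightarrow> 'a set \<Rightarrow> 'b set \<Rightarrow> ('a, 'b) mat2 \<Rightarrow>
   (('a \<Rightarrow> 'l::complete_lattice) \<Rightarrow> 'l, ('b \<Rightarrow> 'l) \<Rightarrow> 'l) mat2" where
  "LFext ast X Y r =
     (\<lambda>(\<xx>, \<yy>)\<in>LF ast X \<times> LF ast Y.
        Sup {a. \<xx> \<sqsubseteq>\<^bsub>LFord ast X\<^esub>
          LFmult ast X
            (LFmap ast Y (LF ast X) (compose Y (LFeta ast X) (mat2_rho X Y r a)) \<yy>)})"

section \<open>Lax algebras\<close>

definition LAlg_obj ::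
  "('l \<Rightarrow> 'l \<Rightarrow> 'l) \<Rightarrow> ('a set \<times> (('a \<Rightarrow> 'l::complete_lattice) \<Rightarrow> 'l, 'a) mat2) set" where
  "LAlg_obj ast =
     {(X, r). r \<in> mat2 (LF ast X) X \<and>
        mat2_le X X (mat2_id X)
          (mat2_comp X (LF ast X) X r (mat2_graph X (LF ast X) (LFunit X))) \<and>
        mat2_le (LF ast (LF ast X)) X
          (mat2_comp (LF ast (LF ast X)) (LF ast X) X r (LFext ast (LF ast X) X r))
          (mat2_comp (LF ast (LF ast X)) (LF ast X) X r
             (mat2_graph (LF ast (LF ast X)) (LF ast X) (LFmult ast X)))}"

definition LAlg_hom ::
  "('l \<Rightarrow> 'l \<Rightarrow> 'l) \<Rightarrow> ('a set \<times> (('a \<Rightarrow> 'l::complete_lattice) \<Rightarrow> 'l, 'a) mat2) \<Rightarrow>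
   ('a set \<times> (('a \<Rightarrow> 'l) \<Rightarrow> 'l, 'a) mat2) \<Rightarrow> ('a \<Rightarrow> 'a) set" where
  "LAlg_hom ast = (\<lambda>(X, r) (Y, s).
     {f \<in> X \<rightarrow>\<^sub>E Y. \<forall>\<xx>\<in>LF ast X. \<forall>y\<in>X. r (\<xx>, y) \<le> s (LFmap ast X Y f \<xx>, f y)})"

definition LAlg ::
  "('l \<Rightarrow> 'l \<Rightarrow> 'l) \<Rightarrow>
   ('a set \<times> (('a \<Rightarrow> 'l::complete_lattice) \<Rightarrow> 'l, 'a) mat2, 'a \<Rightarrow> 'a) cat" where
  "LAlg ast =
     \<lparr>Obj = LAlg_obj ast, Hom = LAlg_hom ast,
      Ident = (\<lambda>(X, r). \<lambda>x\<in>X. x),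
      Cmp = (\<lambda>(X, r) _ _ g f. compose X g f)\<rparr>"

section \<open>Well-definedness\<close>

lemma LpowI [intro]: "(\<lambda>x\<in>X. h x) \<in> Lpow X"
  by (auto simp: Lpow_def)

lemma compose_Lpow: "compose X A f \<in> Lpow X"
  by (simp add: compose_def LpowI)

lemma LFD:
  assumes "\<ff> \<in> LF ast X"
  shows "\<ff> \<in> extensional (Lpow X)"
    and "\<ff> (\<lambda>x\<in>X. Orderings.top) = Orderings.top"
    and "\<lbrakk>A \<in> Lpow X; B \<in> Lpow X; \<And>x. x \<in> X \<Longrightarrow> A x \<le> B x\<rbrakk> \<Longrightarrow> \<ff> A \<le> \<ff> B"
    and "\<lbrakk>A \<in> Lpow X; B \<in> Lpow X\<rbrakk> \<Longrightarrow> ast (\<ff> A) (\<ff> B) \<le> \<ff> (\<lambda>x\<in>X. ast (A x) (B x))"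
  using assms unfolding LF_def is_Lfilter_def by (auto simp: PiE_def)

lemma LFI:
  assumes "\<ff> (\<lambda>x\<in>X. Orderings.top) = Orderings.top"
    and "\<And>A B. \<lbrakk>A \<in> Lpow X; B \<in> Lpow X; \<And>x. x \<in> X \<Longrightarrow> A x \<le> B x\<rbrakk> \<Longrightarrow> \<ff> A \<le> \<ff> B"
    and "\<And>A B. \<lbrakk>A \<in> Lpow X; B \<in> Lpow X\<rbrakk> \<Longrightarrow> ast (\<ff> A) (\<ff> B) \<le> \<ff> (\<lambda>x\<in>X. ast (A x) (B x))"
  shows "restrict \<ff> (Lpow X) \<in> LF ast X"
  using assms unfolding LF_def is_Lfilter_def by (auto simp: LpowI)

lemma LFunit_in: "LFunit X \<in> X \<rightarrow>\<^sub>E LF ast X"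
proof (rule PiE_I)
  fix x assume "x \<in> X"
  then show "LFunit X x \<in> LF ast X"
    unfolding LFunit_def by (simp, intro LFI) auto
qed (auto simp: LFunit_def)

lemma LFmap_in:
  assumes f: "f \<in> X \<rightarrow>\<^sub>E Y"
  shows "LFmap ast X Y f \<in> LF ast X \<rightarrow>\<^sub>E LF ast Y"
proof (rule PiE_I)
  fix \<ff> assume \<ff>: "\<ff> \<in> LF ast X"
  note D = LFD[OF \<ff>]
  have 1: "compose X (\<lambda>x\<in>Y. Orderings.top) f = (\<lambda>x\<in>X. Orderings.top)"
    using f by (auto simp: compose_def restrict_def fun_eq_iff PiE_iff)
  have 2: "compose X (\<lambda>x\<in>Y. ast (A x) (B x)) f =
      (\<lambda>x\<in>X. ast (compose X A f x) (compose X B f x))" for A B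
    using f by (auto simp: compose_def restrict_def fun_eq_iff PiE_iff)
  have "(\<lambda>A\<in>Lpow Y. \<ff> (compose X A f)) \<in> LF ast Y"
  proof (rule LFI)
    show "\<ff> (compose X (\<lambda>x\<in>Y. Orderings.top) f) = Orderings.top"
      by (simp only: 1 D(2))
  next
    fix A B :: "'b \<Rightarrow> 'c"
    assume "A \<in> Lpow Y" "B \<in> Lpow Y" "\<And>x. x \<in> Y \<Longrightarrow> A x \<le> B x"
    then show "\<ff> (compose X A f) \<le> \<ff> (compose X B f)"
      using f by (intro D(3) compose_Lpow) (auto simp: compose_def)
  next
    fix A B :: "'b \<Rightarrow> 'c"
    show "ast (\<ff> (compose X A f)) (\<ff> (compose X B f)) \<le>
        \<ff> (compose X (\<lambda>x\<in>Y. ast (A x) (B x)) f)"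
      unfolding 2 by (intro D(4) compose_Lpow)
  qed
  then show "LFmap ast X Y f \<ff> \<in> LF ast Y"
    using \<ff> by (simp add: LFmap_def)
qed (auto simp: LFmap_def)

lemma LFmult_in: "LFmult ast X \<in> LF ast (LF ast X) \<rightarrow>\<^sub>E LF ast X"
proof (rule PiE_I)
  fix \<FF> assume \<FF>: "\<FF> \<in> LF ast (LF ast X)"
  note D = LFD[OF \<FF>]
  have ev: "LFev ast X A \<in> Lpow (LF ast X)" for A
    unfolding LFev_def by (rule LpowI)
  have "(\<lambda>A\<in>Lpow X. \<FF> (LFev ast X A)) \<in> LF ast X"
  proof (rule LFI)
    have "LFev ast X (\<lambda>x\<in>X. Orderings.top) = (\<lambda>\<ff>\<in>LF ast X. Orderings.top)"
      by (auto simp: LFev_def restrict_def LFD(2)[unfolded restrict_def])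
    then show "\<FF> (LFev ast X (\<lambda>x\<in>X. Orderings.top)) = Orderings.top"
      by (simp only: D(2))
  next
    fix A B :: "'a \<Rightarrow> 'b"
    assume "A \<in> Lpow X" "B \<in> Lpow X" "\<And>x. x \<in> X \<Longrightarrow> A x \<le> B x"
    then show "\<FF> (LFev ast X A) \<le> \<FF> (LFev ast X B)"
      by (intro D(3) ev) (auto simp: LFev_def intro: LFD(3))
  next
    fix A B :: "'a \<Rightarrow> 'b"
    assume AB: "A \<in> Lpow X" "B \<in> Lpow X"
    have "ast (\<FF> (LFev ast X A)) (\<FF> (LFev ast X B)) \<le>
        \<FF> (\<lambda>\<ff>\<in>LF ast X. ast (LFev ast X A \<ff>) (LFev ast X B \<ff>))"
      by (intro D(4) ev)
    also have "\<dots> \<le> \<FF> (LFev ast X (\<lambda>x\<in>X. ast (A x) (B x)))"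
      using AB by (intro D(3) ev LpowI) (auto simp: LFev_def intro: LFD(4))
    finally show "ast (\<FF> (LFev ast X A)) (\<FF> (LFev ast X B)) \<le>
        \<FF> (LFev ast X (\<lambda>x\<in>X. ast (A x) (B x)))" .
  qed
  then show "LFmult ast X \<FF> \<in> LF ast X"
    using \<FF> by (simp add: LFmult_def)
qed (auto simp: LFmult_def)

lemma LFord_partial_order: "partial_order (LFord ast X)"
proof (unfold_locales; (simp add: LFord_def)?)
  fix \<ff> \<gg>
  assume le: "\<forall>A\<in>Lpow X. \<gg> A \<le> \<ff> A" "\<forall>A\<in>Lpow X. \<ff> A \<le> \<gg> A"
    and mem: "\<ff> \<in> LF ast X" "\<gg> \<in> LF ast X"
  show "\<ff> = \<gg>"
    by (rule extensionalityI[OF LFD(1)[OF mem(1)] LFD(1)[OF mem(2)]])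
      (use le in \<open>auto intro: antisym\<close>)
qed (auto intro: order_trans)

text \<open>Joins in the (reversed) order on L-valued filters are pointwise meets.\<close>

lemma Inf_in_LF:
  fixes ast :: "'l::complete_lattice \<Rightarrow> 'l \<Rightarrow> 'l"
  assumes mono: "\<And>a b c d. \<lbrakk>a \<le> b; c \<le> d\<rbrakk> \<Longrightarrow> ast a c \<le> ast b d"
    and S: "S \<subseteq> LF ast X"
  shows "(\<lambda>A\<in>Lpow X. INF \<ff>\<in>S. \<ff> A) \<in> LF ast X"
proof (rule LFI)
  show "(INF \<ff>\<in>S. \<ff> (\<lambda>x\<in>X. Orderings.top)) = Orderings.top"
    using S by (auto simp: LFD(2) subset_iff)
next
  fix A B :: "'a \<Rightarrow> 'l"
  assume "A \<in> Lpow X" "B \<in> Lpow X" "\<And>x. x \<in> X \<Longrightarrow> A x \<le> B x"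
  then show "(INF \<ff>\<in>S. \<ff> A) \<le> (INF \<ff>\<in>S. \<ff> B)"
    using S by (intro INF_mono) (blast intro: LFD(3))
next
  fix A B :: "'a \<Rightarrow> 'l"
  assume AB: "A \<in> Lpow X" "B \<in> Lpow X"
  show "ast (INF \<ff>\<in>S. \<ff> A) (INF \<ff>\<in>S. \<ff> B) \<le> (INF \<ff>\<in>S. \<ff> (\<lambda>x\<in>X. ast (A x) (B x)))"
  proof (rule INF_greatest)
    fix \<ff> assume "\<ff> \<in> S"
    then have "ast (INF \<ff>\<in>S. \<ff> A) (INF \<ff>\<in>S. \<ff> B) \<le> ast (\<ff> A) (\<ff> B)"
      by (intro mono INF_lower)
    also have "\<dots> \<le> \<ff> (\<lambda>x\<in>X. ast (A x) (B x))"
      using \<open>\<ff> \<in> S\<close> S AB by (auto intro: LFD(4))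
    finally show "ast (INF \<ff>\<in>S. \<ff> A) (INF \<ff>\<in>S. \<ff> B) \<le> \<ff> (\<lambda>x\<in>X. ast (A x) (B x))" .
  qed
qed

lemma LFord_least_Upper:
  fixes ast :: "'l::complete_lattice \<Rightarrow> 'l \<Rightarrow> 'l"
  assumes mono: "\<And>a b c d. \<lbrakk>a \<le> b; c \<le> d\<rbrakk> \<Longrightarrow> ast a c \<le> ast b d"
    and S: "S \<subseteq> LF ast X"
  shows "least (LFord ast X) (\<lambda>A\<in>Lpow X. INF \<ff>\<in>S. \<ff> A) (Upper (LFord ast X) S)"
  using Inf_in_LF[OF mono S] S
  unfolding least_def Upper_def LFord_def
  by (fastforce intro: INF_lower INF_greatest)

lemma LFord_sup:
  fixes ast :: "'l::complete_lattice \<Rightarrow> 'l \<Rightarrow> 'l"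
  assumes mono: "\<And>a b c d. \<lbrakk>a \<le> b; c \<le> d\<rbrakk> \<Longrightarrow> ast a c \<le> ast b d"
    and S: "S \<subseteq> LF ast X"
  shows "\<Squnion>\<^bsub>LFord ast X\<^esub> S = (\<lambda>A\<in>Lpow X. INF \<ff>\<in>S. \<ff> A)"
proof -
  interpret partial_order "LFord ast X" by (rule LFord_partial_order)
  have L: "least (LFord ast X) (\<lambda>A\<in>Lpow X. INF \<ff>\<in>S. \<ff> A) (Upper (LFord ast X) S)"
    by (rule LFord_least_Upper[OF mono S])
  show ?thesis
    unfolding Lattice.sup_def by (rule some_equality, rule L, rule least_unique[OF _ L])
qed

lemma LFord_complete_lattice:
  fixes ast :: "'l::complete_lattice \<Rightarrow> 'l \<Rightarrow> 'l"
  assumes mono: "\<And>a b c d. \<lbrakk>a \<le> b; c \<le> d\<rbrakk> \<Longrightarrow> ast a c \<le> ast b d"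
  shows "complete_lattice (LFord ast X)"
proof -
  interpret partial_order "LFord ast X" by (rule LFord_partial_order)
  have car: "carrier (LFord ast X) = LF ast X" by (simp add: LFord_def)
  show ?thesis
  proof
    fix S assume "S \<subseteq> carrier (LFord ast X)"
    then show "\<exists>s. least (LFord ast X) s (Upper (LFord ast X) S)"
      using LFord_least_Upper[of ast S X, OF mono] by (auto simp: car)
  next
    fix S assume S: "S \<subseteq> carrier (LFord ast X)"
    have low: "Lower (LFord ast X) S \<subseteq> LF ast X" by (auto simp: Lower_def car)
    have "greatest (LFord ast X) (\<lambda>A\<in>Lpow X. INF \<ff>\<in>Lower (LFord ast X) S. \<ff> A)
        (Lower (LFord ast X) S)"
      using LFord_least_Upper[of ast _ X, OF mono low] S low
      unfolding least_def greatest_def Upper_def Lower_def car by blast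
    then show "\<exists>i. greatest (LFord ast X) i (Lower (LFord ast X) S)" by blast
  qed
qed

lemma LFeta_eq:
  fixes ast :: "'l::complete_lattice \<Rightarrow> 'l \<Rightarrow> 'l"
  assumes mono: "\<And>a b c d. \<lbrakk>a \<le> b; c \<le> d\<rbrakk> \<Longrightarrow> ast a c \<le> ast b d"
    and S: "S \<subseteq> X"
  shows "LFeta ast X S = (\<lambda>A\<in>Lpow X. INF x\<in>S. A x)"
proof -
  have "LFunit X ` S \<subseteq> LF ast X" using LFunit_in S by fastforce
  then have "LFeta ast X S = (\<lambda>A\<in>Lpow X. INF \<ff>\<in>LFunit X ` S. \<ff> A)"
    using LFord_sup[of ast _ X, OF mono] S by (simp add: LFeta_def)
  also have "\<dots> = (\<lambda>A\<in>Lpow X. INF x\<in>S. A x)"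
    using S by (intro restrict_ext) (auto simp: LFunit_def image_image subset_iff intro!: INF_cong)
  finally show ?thesis .
qed

end

theory Submission
  imports Defs
begin

text \<open>A lax algebra structure \<open>r\<close> on \<open>X\<close> corresponds to the map \<open>\<alpha>\<close> sending \<open>y\<close> to the join of all
  filters \<open>\<xx>\<close> with \<open>r (\<xx>, y)\<close>; conversely \<open>\<alpha>\<close> gives the relation \<open>\<xx> \<le> \<alpha> y\<close>. The point is that
  the filters related to a fixed \<open>y\<close> form a principal down-set. Transitivity of \<open>r\<close>, applied to
  \<open>Te \<xx>\<close>, shows that they are closed downwards; applied to the join of the principal filters
  at all filters related to \<open>y\<close>, it shows that they are closed under their join. Applied to
  \<open>T\<alpha> (\<alpha> x)\<close> it yields \<open>\<alpha> \<circ> \<alpha> \<le> \<alpha>\<close>. Both kinds of morphisms \<open>f\<close> then amount to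
  \<open>Tf \<cdot> \<alpha> \<le> \<beta> \<cdot> f\<close>.\<close>

section \<open>Values of the monad operations at a single L-subset\<close>

lemma LFord_le_iff: "\<ff> \<sqsubseteq>\<^bsub>LFord ast X\<^esub> \<gg> \<longleftrightarrow> (\<forall>A\<in>Lpow X. \<gg> A \<le> \<ff> A)"
  by (simp add: LFord_def)

text \<open>Evaluating \<open>m \<cdot> T\<beta>\<close> at \<open>A\<close> applies
  \<open>\<ff>\<close> to \<open>LFev ast Z A\<close> after \<open>\<beta>\<close>, which is the map
  in \<open>y\<close> on the right. Kleisli composites and the Kleisli extension are computed
  through this formula, so that filters on filters vanish from their conditions.\<close>

lemma LFmult_LFmap:
  assumes \<beta>: "\<beta> \<in> Y \<rightarrow>\<^sub>E LF ast Z" and \<ff>: "\<ff> \<in> LF ast Y" and A: "A \<in> Lpow Z"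
  shows "LFmult ast Z (LFmap ast Y (LF ast Z) \<beta> \<ff>) A = \<ff> (\<lambda>y\<in>Y. \<beta> y A)"
proof -
  have "LFmap ast Y (LF ast Z) \<beta> \<ff> \<in> LF ast (LF ast Z)"
    by (rule PiE_mem[OF LFmap_in[OF \<beta>] \<ff>])
  moreover have "LFev ast Z A \<in> Lpow (LF ast Z)"
    unfolding LFev_def by (rule LpowI)
  moreover have "compose Y (LFev ast Z A) \<beta> = (\<lambda>y\<in>Y. \<beta> y A)"
    using \<beta> by (auto simp: compose_def LFev_def restrict_def fun_eq_iff PiE_iff)
  ultimately show ?thesis
    using \<ff> A by (simp add: LFmult_def LFmap_def)
qed

lemma LFkleisli_apply:
  assumes "\<alpha> \<in> X \<rightarrow>\<^sub>E LF ast Y" "\<beta> \<in> Y \<rightarrow>\<^sub>E LF ast Z" "x \<in> X" "A \<in> Lpow Z"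
  shows "LFkleisli ast X Y Z \<beta> \<alpha> x A = \<alpha> x (\<lambda>y\<in>Y. \<beta> y A)"
  using LFmult_LFmap[OF assms(2) _ assms(4), of "\<alpha> x"] assms(1,3)
  by (auto simp: LFkleisli_def compose_def)

lemma LFunit_apply: "x \<in> X \<Longrightarrow> A \<in> Lpow X \<Longrightarrow> LFunit X x A = A x"
  by (simp add: LFunit_def)

lemma LFmult_apply:
  "\<FF> \<in> LF ast (LF ast X) \<Longrightarrow> A \<in> Lpow X \<Longrightarrow> LFmult ast X \<FF> A = \<FF> (\<lambda>\<ff>\<in>LF ast X. \<ff> A)"
  by (simp add: LFmult_def LFev_def)

lemma LFmap_apply:
  "\<ff> \<in> LF ast X \<Longrightarrow> A \<in> Lpow Y \<Longrightarrow> LFmap ast X Y f \<ff> A = \<ff> (compose X A f)"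
  by (simp add: LFmap_def)

lemma LF_eqI:
  assumes "\<ff> \<in> LF ast X" "\<gg> \<in> LF ast X" "\<And>A. A \<in> Lpow X \<Longrightarrow> \<ff> A = \<gg> A"
  shows "\<ff> = \<gg>"
  using extensionalityI[OF LFD(1)[OF assms(1)] LFD(1)[OF assms(2)]] assms(3) by blast

lemma compose_Lpow_id: "A \<in> Lpow X \<Longrightarrow> compose X A (\<lambda>x\<in>X. x) = A"
  by (auto simp: compose_def Lpow_def fun_eq_iff restrict_def PiE_iff extensional_def)

section \<open>Objects and morphisms of Top(L) in terms of values\<close>

lemma mem_LTop_obj_iff:
  "(X, \<alpha>) \<in> LTop_obj ast \<longleftrightarrow>
     \<alpha> \<in> X \<rightarrow>\<^sub>E LF ast X \<and>
     (\<forall>x\<in>X. \<forall>A\<in>Lpow X. \<alpha> x A \<le> A x) \<and>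
     (\<forall>x\<in>X. \<forall>A\<in>Lpow X. \<alpha> x A \<le> \<alpha> x (\<lambda>y\<in>X. \<alpha> y A))"
  by (auto simp: LTop_obj_def LFmap_le_def LFord_le_iff LFunit_apply LFkleisli_apply)

text \<open>Both Kleisli composites with \<open>e \<cdot> f\<close> collapse: one becomes
  \<open>Tf \<cdot> \<alpha>\<close>, the other \<open>\<beta> \<cdot> f\<close>. The inequality
  between values points the other way because filters are ordered in reverse.\<close>

lemma mem_LTop_hom_iff:
  assumes \<alpha>: "\<alpha> \<in> X \<rightarrow>\<^sub>E LF ast X" and \<beta>: "\<beta> \<in> Y \<rightarrow>\<^sub>E LF ast Y"
  shows "f \<in> LTop_hom ast (X, \<alpha>) (Y, \<beta>) \<longleftrightarrow>
    f \<in> X \<rightarrow>\<^sub>E Y \<and> (\<forall>x\<in>X. \<forall>A\<in>Lpow Y. \<beta> (f x) A \<le> \<alpha> x (compose X A f))"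
proof (cases "f \<in> X \<rightarrow>\<^sub>E Y")
  case f: True
  have e: "compose X (LFunit Y) f \<in> X \<rightarrow>\<^sub>E LF ast Y"
    using f LFunit_in[of Y ast] by (auto simp: compose_def)
  have "(\<lambda>y\<in>X. compose X (LFunit Y) f y A) = compose X A f" if "A \<in> Lpow Y" for A :: "_ \<Rightarrow> 'b"
    using f that by (auto simp: compose_def restrict_def fun_eq_iff LFunit_apply PiE_iff)
  moreover have "compose X (LFunit Y) f x (\<lambda>y\<in>Y. \<beta> y A) = \<beta> (f x) A" if "x \<in> X" for x A
    using f that by (auto simp: compose_def LFunit_apply LpowI PiE_iff)
  ultimately show ?thesis
    using f by (simp add: LTop_hom_def LFmap_le_def LFord_le_iff
        LFkleisli_apply[OF \<alpha> e] LFkleisli_apply[OF e \<beta>])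
qed (simp add: LTop_hom_def)

section \<open>The translations between relations and maps into filters\<close>

definition rel_filters :: "('l \<Rightarrow> 'l \<Rightarrow> 'l) \<Rightarrow> 'a set \<Rightarrow> ((('a \<Rightarrow> 'l::complete_lattice) \<Rightarrow> 'l), 'b) mat2 \<Rightarrow>
    'b \<Rightarrow> (('a \<Rightarrow> 'l) \<Rightarrow> 'l) set" where
  "rel_filters ast X r y = {\<xx> \<in> LF ast X. r (\<xx>, y)}"

text \<open>A join of filters, written as an infimum because the order on filters reverses the order
  of values.\<close>

definition sup_map :: "('l \<Rightarrow> 'l \<Rightarrow> 'l) \<Rightarrow> 'a set \<Rightarrow> ((('a \<Rightarrow> 'l::complete_lattice) \<Rightarrow> 'l), 'a) mat2 \<Rightarrow>
    'a \<Rightarrow> (('a \<Rightarrow> 'l) \<Rightarrow> 'l)" where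
  "sup_map ast X r = (\<lambda>y\<in>X. \<lambda>A\<in>Lpow X. INF \<xx>\<in>rel_filters ast X r y. \<xx> A)"

definition below_rel :: "('l \<Rightarrow> 'l \<Rightarrow> 'l) \<Rightarrow> 'a set \<Rightarrow> ('a \<Rightarrow> (('a \<Rightarrow> 'l::complete_lattice) \<Rightarrow> 'l)) \<Rightarrow>
    (('a \<Rightarrow> 'l) \<Rightarrow> 'l, 'a) mat2" where
  "below_rel ast X \<alpha> = (\<lambda>(\<xx>, y)\<in>LF ast X \<times> X. \<forall>A\<in>Lpow X. \<alpha> y A \<le> \<xx> A)"

lemma rel_filters_subset: "rel_filters ast X r y \<subseteq> LF ast X"
  by (auto simp: rel_filters_def)

section \<open>Category laws and isomorphisms for sets with structure\<close>

text \<open>Extensional maps already satisfy the unit and associativity laws, so only closure of the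
  hom-sets under identities and composition depends on the structures.\<close>

lemma is_category_concrete:
  assumes hom: "\<And>X a Y b. Hom \<C> (X, a) (Y, b) \<subseteq> X \<rightarrow>\<^sub>E Y"
    and ident: "Ident \<C> = (\<lambda>(X, a). \<lambda>x\<in>X. x)"
    and cmp: "Cmp \<C> = (\<lambda>(X, a) _ _ g f. compose X g f)"
    and id_closed: "\<And>A. A \<in> Obj \<C> \<Longrightarrow> Ident \<C> A \<in> Hom \<C> A A"
    and cmp_closed: "\<And>A B C f g. \<lbrakk>A \<in> Obj \<C>; B \<in> Obj \<C>; C \<in> Obj \<C>; f \<in> Hom \<C> A B; g \<in> Hom \<C> B C\<rbrakk>
      \<Longrightarrow> Cmp \<C> A B C g f \<in> Hom \<C> A C"
  shows "is_category \<C>"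
  unfolding is_category_def
proof (intro conjI ballI)
  fix A B f assume "f \<in> Hom \<C> A B"
  then have f: "f \<in> fst A \<rightarrow>\<^sub>E fst B"
    using hom[of "fst A" "snd A" "fst B" "snd B"] by auto
  show "Cmp \<C> A A B f (Ident \<C> A) = f" "Cmp \<C> A B B (Ident \<C> B) f = f"
    using f by (auto simp: ident cmp compose_def restrict_def fun_eq_iff PiE_iff extensional_def
        split: prod.split)
next
  fix A B C D f g h
  assume "f \<in> Hom \<C> A B"
  then have "f \<in> fst A \<rightarrow>\<^sub>E fst B"
    using hom[of "fst A" "snd A" "fst B" "snd B"] by auto
  then show "Cmp \<C> A C D h (Cmp \<C> A B C g f) = Cmp \<C> A B D (Cmp \<C> B C D h g) f"
    by (auto simp: cmp compose_def restrict_def fun_eq_iff PiE_iff split: prod.split)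
qed (use id_closed cmp_closed in auto)

text \<open>Closure of the hom-sets reduces to functoriality of \<open>T\<close>, which is checked
  on values.\<close>

lemma is_category_LAlg:
  "is_category (LAlg ast :: ('a set \<times> (('a \<Rightarrow> 'l::complete_lattice) \<Rightarrow> 'l, 'a) mat2, 'a \<Rightarrow> 'a) cat)"
proof (rule is_category_concrete)
  have id: "LFmap ast X X (\<lambda>x\<in>X. x) \<xx> = \<xx>" if "\<xx> \<in> LF ast X" for X :: "'a set" and \<xx>
  proof (rule LF_eqI[OF _ that])
    show "LFmap ast X X (\<lambda>x\<in>X. x) \<xx> \<in> LF ast X"
      using LFmap_in[of "\<lambda>x\<in>X. x" X X ast] that by auto
    fix A :: "'a \<Rightarrow> 'l" assume "A \<in> Lpow X"
    then show "LFmap ast X X (\<lambda>x\<in>X. x) \<xx> A = \<xx> A"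
      using that by (simp add: LFmap_apply compose_Lpow_id)
  qed
  show "Ident (LAlg ast) A \<in> Hom (LAlg ast) A A"
    for A :: "'a set \<times> (('a \<Rightarrow> 'l) \<Rightarrow> 'l, 'a) mat2"
    by (auto simp: LAlg_def LAlg_hom_def id split: prod.split)
next
  fix A B C :: "'a set \<times> (('a \<Rightarrow> 'l) \<Rightarrow> 'l, 'a) mat2" and f g
  assume f': "f \<in> Hom (LAlg ast) A B" and g': "g \<in> Hom (LAlg ast) B C"
  obtain X r Y s Z t where [simp]: "A = (X, r)" "B = (Y, s)" "C = (Z, t)" by (metis surj_pair)
  have f: "f \<in> X \<rightarrow>\<^sub>E Y" and g: "g \<in> Y \<rightarrow>\<^sub>E Z"
    using f' g' by (auto simp: LAlg_def LAlg_hom_def)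
  have gf: "compose X g f \<in> X \<rightarrow>\<^sub>E Z" using f g by (auto simp: compose_def)
  have "LFmap ast X Z (compose X g f) \<xx> = LFmap ast Y Z g (LFmap ast X Y f \<xx>)"
    if \<xx>: "\<xx> \<in> LF ast X" for \<xx>
  proof -
    have f\<xx>: "LFmap ast X Y f \<xx> \<in> LF ast Y" by (rule PiE_mem[OF LFmap_in[OF f] \<xx>])
    show ?thesis
    proof (rule LF_eqI[of _ ast Z])
      show "LFmap ast X Z (compose X g f) \<xx> \<in> LF ast Z" by (rule PiE_mem[OF LFmap_in[OF gf] \<xx>])
      show "LFmap ast Y Z g (LFmap ast X Y f \<xx>) \<in> LF ast Z" by (rule PiE_mem[OF LFmap_in[OF g] f\<xx>])
      fix A :: "'a \<Rightarrow> 'l" assume "A \<in> Lpow Z"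
      moreover have "compose X A (compose X g f) = compose X (compose Y A g) f"
        using f by (auto simp: compose_def restrict_def fun_eq_iff PiE_iff)
      ultimately show "LFmap ast X Z (compose X g f) \<xx> A = LFmap ast Y Z g (LFmap ast X Y f \<xx>) A"
        using \<xx> f\<xx> by (simp add: LFmap_apply compose_Lpow)
    qed
  qed
  moreover have "LFmap ast X Y f \<xx> \<in> LF ast Y" if "\<xx> \<in> LF ast X" for \<xx>
    by (rule PiE_mem[OF LFmap_in[OF f] that])
  ultimately show "Cmp (LAlg ast) A B C g f \<in> Hom (LAlg ast) A C"
    using f' g' gf f by (auto simp: LAlg_def LAlg_hom_def compose_eq PiE_iff)
qed (auto simp: LAlg_def LAlg_hom_def)

lemma is_category_LTop:
  "is_category (LTop ast :: ('a set \<times> ('a \<Rightarrow> (('a \<Rightarrow> 'l::complete_lattice) \<Rightarrow> 'l)), 'a \<Rightarrow> 'a) cat)"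
proof (rule is_category_concrete)
  fix A :: "'a set \<times> ('a \<Rightarrow> (('a \<Rightarrow> 'l) \<Rightarrow> 'l))"
  assume "A \<in> Obj (LTop ast)"
  moreover obtain X \<alpha> where A: "A = (X, \<alpha>)" by (metis surj_pair)
  ultimately have \<alpha>: "\<alpha> \<in> X \<rightarrow>\<^sub>E LF ast X" by (simp add: LTop_def mem_LTop_obj_iff)
  then show "Ident (LTop ast) A \<in> Hom (LTop ast) A A"
    by (simp add: LTop_def A mem_LTop_hom_iff[OF \<alpha> \<alpha>] compose_Lpow_id)
next
  fix A B C :: "'a set \<times> ('a \<Rightarrow> (('a \<Rightarrow> 'l) \<Rightarrow> 'l))" and f g
  assume obj: "A \<in> Obj (LTop ast)" "B \<in> Obj (LTop ast)" "C \<in> Obj (LTop ast)"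
    and f': "f \<in> Hom (LTop ast) A B" and g': "g \<in> Hom (LTop ast) B C"
  obtain X \<alpha> Y \<beta> Z \<gamma> where [simp]: "A = (X, \<alpha>)" "B = (Y, \<beta>)" "C = (Z, \<gamma>)" by (metis surj_pair)
  have \<alpha>: "\<alpha> \<in> X \<rightarrow>\<^sub>E LF ast X" and \<beta>: "\<beta> \<in> Y \<rightarrow>\<^sub>E LF ast Y" and \<gamma>: "\<gamma> \<in> Z \<rightarrow>\<^sub>E LF ast Z"
    using obj by (simp_all add: LTop_def mem_LTop_obj_iff)
  have f: "f \<in> X \<rightarrow>\<^sub>E Y" and f_le: "\<And>x D. x \<in> X \<Longrightarrow> D \<in> Lpow Y \<Longrightarrow> \<beta> (f x) D \<le> \<alpha> x (compose X D f)"
    using f' mem_LTop_hom_iff[OF \<alpha> \<beta>] by (auto simp: LTop_def)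
  have g: "g \<in> Y \<rightarrow>\<^sub>E Z" and g_le: "\<And>y D. y \<in> Y \<Longrightarrow> D \<in> Lpow Z \<Longrightarrow> \<gamma> (g y) D \<le> \<beta> y (compose Y D g)"
    using g' mem_LTop_hom_iff[OF \<beta> \<gamma>] by (auto simp: LTop_def)
  have "\<gamma> (g (f x)) D \<le> \<alpha> x (compose X D (compose X g f))" if "x \<in> X" "D \<in> Lpow Z" for x D
  proof -
    have "f x \<in> Y" using f that by blast
    then have "\<gamma> (g (f x)) D \<le> \<beta> (f x) (compose Y D g)" using g_le that by simp
    also have "\<dots> \<le> \<alpha> x (compose X (compose Y D g) f)" by (rule f_le[OF that(1) compose_Lpow])
    also have "compose X (compose Y D g) f = compose X D (compose X g f)"
      using f by (auto simp: compose_def restrict_def fun_eq_iff PiE_iff)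
    finally show ?thesis .
  qed
  moreover have "compose X g f \<in> X \<rightarrow>\<^sub>E Z" using f g by (auto simp: compose_def)
  ultimately show "Cmp (LTop ast) A B C g f \<in> Hom (LTop ast) A C"
    by (simp add: LTop_def mem_LTop_hom_iff[OF \<alpha> \<gamma>] compose_eq)
qed (auto simp: LTop_def LTop_hom_def)

text \<open>Both functors keep the underlying set and act as the identity on maps. What remains is a
  bijection of structures on each set under which the same maps are morphisms.\<close>

lemma isomorphic_categories_concrete:
  assumes "is_category \<C>" "is_category \<D>"
    and "\<And>X a. (X, a) \<in> Obj \<C> \<Longrightarrow> (X, F X a) \<in> Obj \<D> \<and> G X (F X a) = a"
    and "\<And>X b. (X, b) \<in> Obj \<D> \<Longrightarrow> (X, G X b) \<in> Obj \<C> \<and> F X (G X b) = b"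
    and hom: "\<And>X a Y b. \<lbrakk>(X, a) \<in> Obj \<C>; (Y, b) \<in> Obj \<C>\<rbrakk>
      \<Longrightarrow> Hom \<C> (X, a) (Y, b) = Hom \<D> (X, F X a) (Y, F Y b)"
    and "Ident \<C> = (\<lambda>(X, a). \<lambda>x\<in>X. x)" "Ident \<D> = (\<lambda>(X, a). \<lambda>x\<in>X. x)"
    and "Cmp \<C> = (\<lambda>(X, a) _ _ g f. compose X g f)" "Cmp \<D> = (\<lambda>(X, a) _ _ g f. compose X g f)"
  shows "isomorphic_categories \<C> \<D>"
proof -
  have hom': "Hom \<D> (X, a) (Y, b) = Hom \<C> (X, G X a) (Y, G Y b)"
    if "(X, a) \<in> Obj \<D>" "(Y, b) \<in> Obj \<D>" for X a Y b
    using hom[of X "G X a" Y "G Y b"] assms(4) that by simp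
  have "is_functor \<C> \<D> (\<lambda>(X, a). (X, F X a)) (\<lambda>_ _ f. f)"
    using assms(3) hom by (auto simp: is_functor_def assms(6-9))
  moreover have "is_functor \<D> \<C> (\<lambda>(X, a). (X, G X a)) (\<lambda>_ _ f. f)"
    using assms(4) hom' by (auto simp: is_functor_def assms(6-9))
  ultimately show ?thesis
    unfolding isomorphic_categories_def using assms(1-4)
    by (intro conjI exI[of _ "\<lambda>(X, a). (X, F X a)"] exI[of _ "\<lambda>(X, a). (X, G X a)"]
        exI[of _ "\<lambda>_ _ f. f"]) auto
qed

section \<open>The Kleisli extension and the axioms of lax algebras\<close>

context
  fixes ast :: "'l::complete_lattice \<Rightarrow> 'l \<Rightarrow> 'l"
  assumes mono: "\<And>a b c d. \<lbrakk>a \<le> b; c \<le> d\<rbrakk> \<Longrightarrow> ast a c \<le> ast b d"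
begin

lemma LFeta_in: "LFeta ast X \<in> Pow X \<rightarrow>\<^sub>E LF ast X"
proof (rule PiE_I)
  fix S assume "S \<in> Pow X"
  then have S: "S \<subseteq> X" by simp
  then have "LFunit X ` S \<subseteq> LF ast X" using LFunit_in by fastforce
  then show "LFeta ast X S \<in> LF ast X"
    using Inf_in_LF[of ast "LFunit X ` S" X, OF mono] LFord_sup[of ast "LFunit X ` S" X, OF mono] S
    by (simp add: LFeta_def)
qed (auto simp: LFeta_def)

text \<open>A join of truth values is true exactly when \<open>True\<close> is among them, so only
  \<open>a = True\<close> counts. For this \<open>a\<close>, the map from \<open>Y\<close> into
  filters takes at \<open>A\<close> the infimum of \<open>A\<close> over the fibre of
  \<open>r\<close> at \<open>y\<close>.\<close>

lemma LFext_iff: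
  assumes \<xx>: "\<xx> \<in> LF ast X" and \<yy>: "\<yy> \<in> LF ast Y"
  shows "LFext ast X Y r (\<xx>, \<yy>) \<longleftrightarrow>
    (\<forall>A\<in>Lpow X. \<yy> (\<lambda>y\<in>Y. INF x\<in>{x\<in>X. r (x, y)}. A x) \<le> \<xx> A)"
proof -
  let ?\<rho> = "compose Y (LFeta ast X) (mat2_rho X Y r True)"
  have \<rho>: "?\<rho> \<in> Y \<rightarrow>\<^sub>E LF ast X"
    using LFeta_in[of X] by (auto simp: compose_def mat2_rho_def PiE_iff)
  have \<rho>_apply: "(\<lambda>y\<in>Y. ?\<rho> y A) = (\<lambda>y\<in>Y. INF x\<in>{x\<in>X. r (x, y)}. A x)" if "A \<in> Lpow X" for A
    using that by (auto simp: compose_def mat2_rho_def LFeta_eq[of ast, OF mono] intro!: restrict_ext)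
  have "LFext ast X Y r (\<xx>, \<yy>) \<longleftrightarrow> \<xx> \<sqsubseteq>\<^bsub>LFord ast X\<^esub> LFmult ast X (LFmap ast Y (LF ast X) ?\<rho> \<yy>)"
    using assms by (auto simp: LFext_def Sup_bool_def)
  then show ?thesis
    by (simp add: LFord_le_iff LFmult_LFmap[OF \<rho> \<yy>] \<rho>_apply)
qed

text \<open>Composition with the graph of a map is substitution, which removes the joins on the
  right-hand sides. The join on the left becomes the universally quantified
  \<open>\<yy>\<close>.\<close>

lemma mem_LAlg_obj_iff:
  "(X, r) \<in> LAlg_obj ast \<longleftrightarrow>
     r \<in> mat2 (LF ast X) X \<and>
     (\<forall>x\<in>X. r (LFunit X x, x)) \<and>
     (\<forall>\<FF>\<in>LF ast (LF ast X). \<forall>\<yy>\<in>LF ast X. \<forall>z\<in>X.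
        (\<forall>\<Phi>\<in>Lpow (LF ast X). \<yy> (\<lambda>y\<in>X. INF \<xx>\<in>rel_filters ast X r y. \<Phi> \<xx>) \<le> \<FF> \<Phi>) \<longrightarrow>
        r (\<yy>, z) \<longrightarrow> r (LFmult ast X \<FF>, z))"
proof -
  have "mat2_le X X (mat2_id X)
          (mat2_comp X (LF ast X) X r (mat2_graph X (LF ast X) (LFunit X)))
        \<longleftrightarrow> (\<forall>x\<in>X. r (LFunit X x, x))"
    using LFunit_in[of X ast]
    by (fastforce simp: mat2_le_def mat2_id_def mat2_comp_def mat2_graph_def)
  moreover have "mat2_le (LF ast (LF ast X)) X
          (mat2_comp (LF ast (LF ast X)) (LF ast X) X r (LFext ast (LF ast X) X r))
          (mat2_comp (LF ast (LF ast X)) (LF ast X) X r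
             (mat2_graph (LF ast (LF ast X)) (LF ast X) (LFmult ast X)))
        \<longleftrightarrow> (\<forall>\<FF>\<in>LF ast (LF ast X). \<forall>z\<in>X. \<forall>\<yy>\<in>LF ast X.
          LFext ast (LF ast X) X r (\<FF>, \<yy>) \<longrightarrow> r (\<yy>, z) \<longrightarrow> r (LFmult ast X \<FF>, z))"
    using LFmult_in[of ast X]
    by (fastforce simp: mat2_le_def mat2_comp_def mat2_graph_def)
  ultimately show ?thesis
    by (simp add: LAlg_obj_def LFext_iff rel_filters_def) blast
qed

lemma sup_map_in: "sup_map ast X r \<in> X \<rightarrow>\<^sub>E LF ast X"
  using Inf_in_LF[of ast _ X, OF mono rel_filters_subset] by (auto simp: sup_map_def)

lemma sup_map_le: "r (\<xx>, y) \<Longrightarrow> \<xx> \<in> LF ast X \<Longrightarrow> y \<in> X \<Longrightarrow> A \<in> Lpow X \<Longrightarrow> sup_map ast X r y A \<le> \<xx> A"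
  by (auto simp: sup_map_def rel_filters_def intro: INF_lower)

section \<open>From a lax algebra to an L-valued topological space\<close>

context
  fixes X :: "'a set" and r :: "(('a \<Rightarrow> 'l) \<Rightarrow> 'l, 'a) mat2"
  assumes alg: "(X, r) \<in> LAlg_obj ast"
begin

lemma LAlg_unit: "x \<in> X \<Longrightarrow> r (LFunit X x, x)"
  using alg by (simp add: mem_LAlg_obj_iff)

lemma LAlg_mult:
  assumes "\<FF> \<in> LF ast (LF ast X)" "\<yy> \<in> LF ast X" "z \<in> X" "r (\<yy>, z)"
    and "\<And>\<Phi>. \<Phi> \<in> Lpow (LF ast X) \<Longrightarrow> \<yy> (\<lambda>y\<in>X. INF \<xx>\<in>rel_filters ast X r y. \<Phi> \<xx>) \<le> \<FF> \<Phi>"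
  shows "r (LFmult ast X \<FF>, z)"
  using alg assms by (simp add: mem_LAlg_obj_iff)

text \<open>Transitivity at \<open>T\<beta> \<xx>\<close>: as \<open>\<beta> y\<close> lies in the
  fibre at \<open>y\<close>, the infimum of \<open>\<Phi>\<close> over that fibre is at most
  \<open>\<Phi> (\<beta> y)\<close>, and monotonicity of \<open>\<yy>\<close> gives the premise. The
  choice \<open>\<beta> = e\<close> yields downward closure, and
  \<open>\<beta> = sup_map ast X r\<close> yields the second axiom of Top(L).\<close>

lemma LAlg_mult_LFmap:
  assumes \<beta>: "\<beta> \<in> X \<rightarrow>\<^sub>E LF ast X" and r\<beta>: "\<And>y. y \<in> X \<Longrightarrow> r (\<beta> y, y)"
    and \<xx>: "\<xx> \<in> LF ast X" and \<yy>: "\<yy> \<in> LF ast X" and le: "\<And>A. A \<in> Lpow X \<Longrightarrow> \<yy> A \<le> \<xx> A"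
    and z: "z \<in> X" "r (\<yy>, z)"
  shows "r (LFmult ast X (LFmap ast X (LF ast X) \<beta> \<xx>), z)"
proof (rule LAlg_mult[OF _ \<yy> z])
  show "LFmap ast X (LF ast X) \<beta> \<xx> \<in> LF ast (LF ast X)"
    by (rule PiE_mem[OF LFmap_in[OF \<beta>] \<xx>])
  fix \<Phi> :: "(('a \<Rightarrow> 'l) \<Rightarrow> 'l) \<Rightarrow> 'l" assume \<Phi>: "\<Phi> \<in> Lpow (LF ast X)"
  have "\<yy> (\<lambda>y\<in>X. INF \<xx>\<in>rel_filters ast X r y. \<Phi> \<xx>) \<le> \<yy> (compose X \<Phi> \<beta>)"
  proof (rule LFD(3)[OF \<yy> LpowI compose_Lpow])
    fix y assume "y \<in> X"
    moreover from this have "\<beta> y \<in> rel_filters ast X r y"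
      using \<beta> r\<beta> by (auto simp: rel_filters_def)
    ultimately show "(\<lambda>y\<in>X. INF \<xx>\<in>rel_filters ast X r y. \<Phi> \<xx>) y \<le> compose X \<Phi> \<beta> y"
      by (auto simp: compose_def intro: INF_lower)
  qed
  also have "\<dots> \<le> \<xx> (compose X \<Phi> \<beta>)"
    by (rule le[OF compose_Lpow])
  finally show "\<yy> (\<lambda>y\<in>X. INF \<xx>\<in>rel_filters ast X r y. \<Phi> \<xx>) \<le> LFmap ast X (LF ast X) \<beta> \<xx> \<Phi>"
    using \<xx> \<Phi> by (simp add: LFmap_apply)
qed

text \<open>Reflexivity allows \<open>\<beta> = e\<close> in the preceding lemma, and the monad law
  \<open>m \<cdot> Te = id\<close> gives back \<open>\<xx>\<close>.\<close>

lemma LAlg_down_closed: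
  assumes \<xx>: "\<xx> \<in> LF ast X" and \<yy>: "\<yy> \<in> LF ast X" and le: "\<And>A. A \<in> Lpow X \<Longrightarrow> \<yy> A \<le> \<xx> A"
    and z: "z \<in> X" "r (\<yy>, z)"
  shows "r (\<xx>, z)"
proof -
  have "(\<lambda>y\<in>X. LFunit X y A) = A" if "A \<in> Lpow X" for A :: "'a \<Rightarrow> 'l"
    using that by (auto simp: LFunit_apply fun_eq_iff restrict_def Lpow_def PiE_iff extensional_def)
  then have "LFmult ast X (LFmap ast X (LF ast X) (LFunit X) \<xx>) = \<xx>"
    using LFmult_LFmap[OF LFunit_in \<xx>] LFmult_in[of ast X] LFmap_in[OF LFunit_in, of ast X ast] \<xx>
    by (intro LF_eqI[of _ ast X]) (auto simp: PiE_iff)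
  then show ?thesis
    using LAlg_mult_LFmap[OF LFunit_in LAlg_unit \<xx> \<yy> le z] by simp
qed

lemma LAlg_sup_map:
  assumes z: "z \<in> X"
  shows "r (sup_map ast X r z, z)"
proof -
  let ?S = "rel_filters ast X r z" and ?T = "LF ast X"
  have S: "?S \<in> Pow ?T" by (simp add: rel_filters_subset)
  have eta: "LFeta ast ?T ?S \<in> LF ast ?T" by (rule PiE_mem[OF LFeta_in S])
  have eta_apply: "LFeta ast ?T ?S \<Phi> = (INF \<xx>\<in>?S. \<Phi> \<xx>)" if "\<Phi> \<in> Lpow ?T" for \<Phi>
    using LFeta_eq[of ast ?S ?T, OF mono] S that by simp
  have u: "LFunit X z \<in> ?T" by (rule PiE_mem[OF LFunit_in z])
  \<comment> \<open>The intermediate filter is \<open>LFunit X z\<close>, related to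
    \<open>z\<close> by reflexivity. Its value at the map of fibrewise infima is the infimum over
    the fibre at \<open>z\<close>, which is the value of \<open>LFeta ast ?T ?S\<close>; the premise
    of transitivity thus holds with equality.\<close>
  have "r (LFmult ast X (LFeta ast ?T ?S), z)"
    using z by (intro LAlg_mult[OF eta u] LAlg_unit) (simp_all add: LFunit_apply LpowI eta_apply)
  moreover have "LFmult ast X (LFeta ast ?T ?S) = sup_map ast X r z"
  proof (rule LF_eqI[of _ ast X])
    show "LFmult ast X (LFeta ast ?T ?S) \<in> ?T" by (rule PiE_mem[OF LFmult_in eta])
    show "sup_map ast X r z \<in> ?T" by (rule PiE_mem[OF sup_map_in z])
    fix A :: "'a \<Rightarrow> 'l" assume "A \<in> Lpow X"
    then show "LFmult ast X (LFeta ast ?T ?S) A = sup_map ast X r z A"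
      using S z by (auto simp: LFmult_apply eta eta_apply LpowI sup_map_def subset_iff intro!: INF_cong)
  qed
  ultimately show ?thesis by simp
qed

text \<open>The fibre at \<open>y\<close> is a principal down-set: it is closed downwards and
  contains its own join.\<close>

lemma LAlg_iff_below_sup_map:
  assumes "\<xx> \<in> LF ast X" "y \<in> X"
  shows "r (\<xx>, y) \<longleftrightarrow> (\<forall>A\<in>Lpow X. sup_map ast X r y A \<le> \<xx> A)"
proof
  assume "r (\<xx>, y)"
  then show "\<forall>A\<in>Lpow X. sup_map ast X r y A \<le> \<xx> A"
    using sup_map_le[of r \<xx> y X] assms by simp
next
  assume "\<forall>A\<in>Lpow X. sup_map ast X r y A \<le> \<xx> A"
  then show "r (\<xx>, y)"
    using LAlg_down_closed[OF assms(1) PiE_mem[OF sup_map_in assms(2)] _ assms(2)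
        LAlg_sup_map[OF assms(2)]] by simp
qed

lemma below_rel_sup_map: "below_rel ast X (sup_map ast X r) = r"
proof -
  \<comment> \<open>Equality as HOL functions also requires agreement outside the carrier, where
    both sides are \<open>undefined\<close>.\<close>
  have "r \<in> extensional (LF ast X \<times> X)"
    using alg by (auto simp: LAlg_obj_def mat2_def PiE_iff)
  then show ?thesis
    by (intro extensionalityI[of _ "LF ast X \<times> X"])
      (auto simp: below_rel_def LAlg_iff_below_sup_map)
qed

text \<open>Each axiom exhibits a filter related to \<open>x\<close>, namely \<open>e x\<close> for
  the first and \<open>m (T\<alpha> (\<alpha> x))\<close> for the second. Such a filter lies below
  the join of the fibre.\<close>

lemma sup_map_in_LTop_obj: "(X, sup_map ast X r) \<in> LTop_obj ast"
  unfolding mem_LTop_obj_iff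
proof (intro conjI ballI)
  fix x and A :: "'a \<Rightarrow> 'l" assume x: "x \<in> X" and A: "A \<in> Lpow X"
  let ?\<alpha> = "sup_map ast X r"
  have u: "LFunit X x \<in> LF ast X" by (rule PiE_mem[OF LFunit_in x])
  show "?\<alpha> x A \<le> A x"
    using sup_map_le[of r, OF LAlg_unit[OF x] u x A] x A by (simp add: LFunit_apply)
  have \<alpha>x: "?\<alpha> x \<in> LF ast X" by (rule PiE_mem[OF sup_map_in x])
  have "r (LFmult ast X (LFmap ast X (LF ast X) ?\<alpha> (?\<alpha> x)), x)"
    by (rule LAlg_mult_LFmap[OF sup_map_in LAlg_sup_map \<alpha>x \<alpha>x order_refl x LAlg_sup_map[OF x]])
  moreover have "LFmult ast X (LFmap ast X (LF ast X) ?\<alpha> (?\<alpha> x)) \<in> LF ast X"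
    by (rule PiE_mem[OF LFmult_in PiE_mem[OF LFmap_in[OF sup_map_in] \<alpha>x]])
  ultimately have "?\<alpha> x A \<le> LFmult ast X (LFmap ast X (LF ast X) ?\<alpha> (?\<alpha> x)) A"
    by (rule sup_map_le[OF _ _ x A])
  then show "?\<alpha> x A \<le> ?\<alpha> x (\<lambda>y\<in>X. ?\<alpha> y A)"
    by (simp add: LFmult_LFmap[OF sup_map_in \<alpha>x A])
qed (rule sup_map_in)

end

section \<open>From an L-valued topological space to a lax algebra\<close>

text \<open>The fibre at \<open>y\<close> is the down-set of \<open>\<alpha> y\<close>, so its join
  is its greatest element \<open>\<alpha> y\<close>.\<close>

lemma sup_map_below_rel:
  assumes \<alpha>: "\<alpha> \<in> X \<rightarrow>\<^sub>E LF ast X"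
  shows "sup_map ast X (below_rel ast X \<alpha>) = \<alpha>"
proof (rule extensionalityI[of _ X])
  fix y assume y: "y \<in> X"
  then have \<alpha>y: "\<alpha> y \<in> LF ast X" using \<alpha> by blast
  show "sup_map ast X (below_rel ast X \<alpha>) y = \<alpha> y"
  proof (rule LF_eqI[OF _ \<alpha>y])
    show "sup_map ast X (below_rel ast X \<alpha>) y \<in> LF ast X" by (rule PiE_mem[OF sup_map_in y])
    fix A :: "'a \<Rightarrow> 'l" assume A: "A \<in> Lpow X"
    show "sup_map ast X (below_rel ast X \<alpha>) y A = \<alpha> y A"
    proof (rule antisym)
      show "sup_map ast X (below_rel ast X \<alpha>) y A \<le> \<alpha> y A"
        using \<alpha>y y A by (intro sup_map_le) (auto simp: below_rel_def)
      show "\<alpha> y A \<le> sup_map ast X (below_rel ast X \<alpha>) y A"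
        using y A by (auto simp: sup_map_def rel_filters_def below_rel_def intro!: INF_greatest)
    qed
  qed
qed (use \<alpha> in \<open>auto simp: sup_map_def PiE_iff\<close>)

lemma below_rel_in_LAlg_obj:
  assumes top: "(X, \<alpha>) \<in> LTop_obj ast"
  shows "(X, below_rel ast X \<alpha>) \<in> LAlg_obj ast"
  unfolding mem_LAlg_obj_iff
proof (intro conjI ballI impI)
  let ?r = "below_rel ast X \<alpha>"
  have \<alpha>: "\<alpha> \<in> X \<rightarrow>\<^sub>E LF ast X" and unit: "\<And>x A. x \<in> X \<Longrightarrow> A \<in> Lpow X \<Longrightarrow> \<alpha> x A \<le> A x"
    and mult: "\<And>x A. x \<in> X \<Longrightarrow> A \<in> Lpow X \<Longrightarrow> \<alpha> x A \<le> \<alpha> x (\<lambda>y\<in>X. \<alpha> y A)"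
    using top by (simp_all add: mem_LTop_obj_iff)
  show "?r \<in> mat2 (LF ast X) X"
    by (simp add: below_rel_def mat2_def)
  show "?r (LFunit X x, x)" if "x \<in> X" for x
    using that LFunit_in[of X ast] unit by (auto simp: below_rel_def LFunit_apply PiE_iff)
  fix \<FF> \<yy> z
  assume \<FF>: "\<FF> \<in> LF ast (LF ast X)" and \<yy>: "\<yy> \<in> LF ast X" and z: "z \<in> X" and r: "?r (\<yy>, z)"
    and le: "\<forall>\<Phi>\<in>Lpow (LF ast X). \<yy> (\<lambda>y\<in>X. INF \<xx>\<in>rel_filters ast X ?r y. \<Phi> \<xx>) \<le> \<FF> \<Phi>"
  have "\<alpha> z A \<le> LFmult ast X \<FF> A" if A: "A \<in> Lpow X" for A
  proof -
    let ?ev = "\<lambda>\<xx>\<in>LF ast X. \<xx> A"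
    have "\<alpha> z A \<le> \<alpha> z (\<lambda>y\<in>X. \<alpha> y A)" by (rule mult[OF z A])
    also have "\<dots> \<le> \<yy> (\<lambda>y\<in>X. \<alpha> y A)"
      using r \<yy> z by (auto simp: below_rel_def LpowI)
    \<comment> \<open>Filters in the fibre at \<open>y\<close> lie below \<open>\<alpha> y\<close>,
      hence their values at \<open>A\<close> are at least \<open>\<alpha> y A\<close>.\<close>
    also have "\<dots> \<le> \<yy> (\<lambda>y\<in>X. INF \<xx>\<in>rel_filters ast X ?r y. ?ev \<xx>)"
      using A by (intro LFD(3)[OF \<yy>] LpowI)
        (auto simp: rel_filters_def below_rel_def intro!: INF_greatest)
    \<comment> \<open>The premise on \<open>\<FF>\<close> is used at evaluation in \<open>A\<close>,
      where \<open>\<FF>\<close> takes the value of \<open>m \<FF>\<close> at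
      \<open>A\<close>.\<close>
    also have "\<dots> \<le> \<FF> ?ev" using bspec[OF le LpowI] by simp
    finally show ?thesis using \<FF> A by (simp add: LFmult_apply)
  qed
  moreover have "LFmult ast X \<FF> \<in> LF ast X" by (rule PiE_mem[OF LFmult_in \<FF>])
  ultimately show "?r (LFmult ast X \<FF>, z)" using z by (simp add: below_rel_def)
qed

section \<open>Comparison of morphisms\<close>

text \<open>As fibres are principal, preservation of the relation can be tested on the largest
  filter related to each point. The other related filters follow by transitivity, since their values
  dominate those of the join.\<close>

lemma LAlg_hom_eq_LTop_hom:
  assumes X: "(X, r) \<in> LAlg_obj ast" and Y: "(Y, s) \<in> LAlg_obj ast"
  shows "LAlg_hom ast (X, r) (Y, s) = LTop_hom ast (X, sup_map ast X r) (Y, sup_map ast Y s)"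
proof -
  have "(\<forall>\<xx>\<in>LF ast X. \<forall>y\<in>X. r (\<xx>, y) \<longrightarrow> s (LFmap ast X Y f \<xx>, f y)) \<longleftrightarrow>
    (\<forall>x\<in>X. \<forall>A\<in>Lpow Y. sup_map ast Y s (f x) A \<le> sup_map ast X r x (compose X A f))"
    (is "?L \<longleftrightarrow> ?R") if f: "f \<in> X \<rightarrow>\<^sub>E Y" for f
  proof -
    have s: "s (LFmap ast X Y f \<xx>, f y) \<longleftrightarrow>
        (\<forall>A\<in>Lpow Y. sup_map ast Y s (f y) A \<le> \<xx> (compose X A f))"
      if "\<xx> \<in> LF ast X" "y \<in> X" for \<xx> y
      using LAlg_iff_below_sup_map[OF Y, of "LFmap ast X Y f \<xx>" "f y"] LFmap_in[OF f, of ast] f that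
      by (auto simp: LFmap_apply PiE_iff)
    show ?thesis
    proof
      assume L: ?L
      show ?R
      proof
        fix x assume x: "x \<in> X"
        have \<alpha>x: "sup_map ast X r x \<in> LF ast X" by (rule PiE_mem[OF sup_map_in x])
        then show "\<forall>A\<in>Lpow Y. sup_map ast Y s (f x) A \<le> sup_map ast X r x (compose X A f)"
          using L LAlg_sup_map[OF X x] x s[OF \<alpha>x x] by simp
      qed
    next
      assume R: ?R
      show ?L
      proof (intro ballI impI)
        fix \<xx> y assume \<xx>: "\<xx> \<in> LF ast X" and y: "y \<in> X" and r: "r (\<xx>, y)"
        have "sup_map ast X r y (compose X A f) \<le> \<xx> (compose X A f)" for A
          by (rule sup_map_le[of r, OF r \<xx> y compose_Lpow])
        then show "s (LFmap ast X Y f \<xx>, f y)"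
          unfolding s[OF \<xx> y] using R y order_trans by blast
      qed
    qed
  qed
  then show ?thesis
    by (simp add: set_eq_iff mem_LTop_hom_iff[OF sup_map_in sup_map_in] LAlg_hom_def cong: conj_cong)
qed

end

theorem proposition6p3:
  fixes ast :: "'l::complete_lattice \<Rightarrow> 'l \<Rightarrow> 'l"
  assumes "\<And>a b c. a \<le> b \<Longrightarrow> ast a c \<le> ast b c"
    and "\<And>a b c. a \<le> b \<Longrightarrow> ast c a \<le> ast c b"
  shows "isomorphic_categories
           (LAlg ast :: ('a set \<times> (('a \<Rightarrow> 'l) \<Rightarrow> 'l, 'a) mat2, 'a \<Rightarrow> 'a) cat)
           (LTop ast :: ('a set \<times> ('a \<Rightarrow> (('a \<Rightarrow> 'l) \<Rightarrow> 'l)), 'a \<Rightarrow> 'a) cat)"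
proof -
  \<comment> \<open>Monotonicity in each variable separately gives the joint form needed for closure
    of filters under pointwise infima.\<close>
  have mono: "ast a c \<le> ast b d" if "a \<le> b" "c \<le> d" for a b c d
    using assms that order_trans by blast
  show ?thesis
  proof (rule isomorphic_categories_concrete[where F = "sup_map ast" and G = "below_rel ast"])
    fix X :: "'a set" and r :: "(('a \<Rightarrow> 'l) \<Rightarrow> 'l, 'a) mat2"
    assume "(X, r) \<in> Obj (LAlg ast)"
    then show "(X, sup_map ast X r) \<in> Obj (LTop ast) \<and> below_rel ast X (sup_map ast X r) = r"
      by (simp add: LAlg_def LTop_def sup_map_in_LTop_obj[of ast, OF mono]
          below_rel_sup_map[of ast, OF mono])
  next
    fix X :: "'a set" and \<alpha> :: "'a \<Rightarrow> ('a \<Rightarrow> 'l) \<Rightarrow> 'l"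
    assume "(X, \<alpha>) \<in> Obj (LTop ast)"
    then show "(X, below_rel ast X \<alpha>) \<in> Obj (LAlg ast) \<and> sup_map ast X (below_rel ast X \<alpha>) = \<alpha>"
      using sup_map_below_rel[of ast \<alpha> X, OF mono] below_rel_in_LAlg_obj[of ast X \<alpha>, OF mono]
      by (simp add: LAlg_def LTop_def mem_LTop_obj_iff)
  next
    fix X Y :: "'a set" and r s :: "(('a \<Rightarrow> 'l) \<Rightarrow> 'l, 'a) mat2"
    assume "(X, r) \<in> Obj (LAlg ast)" "(Y, s) \<in> Obj (LAlg ast)"
    then show "Hom (LAlg ast) (X, r) (Y, s) =
        Hom (LTop ast) (X, sup_map ast X r) (Y, sup_map ast Y s)"
      using LAlg_hom_eq_LTop_hom[of ast X r Y s, OF mono] by (simp add: LAlg_def LTop_def)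
  qed (rule is_category_LAlg is_category_LTop |
      simp add: LAlg_def LTop_def)+
qed

end
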